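(* Let $T$ be the $H_3(\mathbb R)$-odometer associated with a nested sequence $\Gamma_1\supset\Gamma_2\supset\cdots$ of lattices in $H_3(\mathbb R)$. Then $T$ is free if and only if $\{c(t):t\in\mathbb R\}\cap\bigcap_{n=1}^\infty\Gamma_n=\{1\}$.
   Context: $H_3(\mathbb R)$: real $3\times3$ upper triangular unipotent matrices; $c(t)$ is the matrix with $(1,3)$ entry $t$ and other off-diagonal entries $0$, so $\{c(t)\}$ is the center. A lattice is a discrete subgroup of finite covolume. The $H_3(\mathbb R)$-odometer associated with the sequence is the left-translation action on $X=\varprojlim H_3(\mathbb R)/\Gamma_j$ with the invariant probability $\mu$ which is the inverse limit of the invariant probabilities on $H_3(\mathbb R)/\Gamma_j$. The action is free if for $\mu$-a.e. $x$ the stability group $\{g:T_gx=x\}$ is trivial. *)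

theory Defs
  imports "HOL-Analysis.Analysis" "HOL-Probability.Probability"
begin

type_synonym mat3 = "real^3^3"

definition H3 :: "mat3 set" where
  "H3 = {M. M$1$1 = 1 \<and> M$2$2 = 1 \<and> M$3$3 = 1 \<and> M$2$1 = 0 \<and> M$3$1 = 0 \<and> M$3$2 = 0}"

definition hmat :: "real \<times> real \<times> real \<Rightarrow> mat3" where
  "hmat p = (\<chi> i j. if i = j then 1
                     else if i = 1 \<and> j = 2 then fst p
                     else if i = 2 \<and> j = 3 then fst (snd p)
                     else if i = 1 \<and> j = 3 then snd (snd p) else 0)"

definition cent :: "real \<Rightarrow> mat3" where
  "cent t = hmat (0, 0, t)"

text \<open>Haar measure of H_3(R): Lebesgue measure da db dt in the coordinates above
  (H_3(R) is unimodular and this measure is left and right invariant).\<close>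
definition haar_measurable :: "mat3 set \<Rightarrow> bool" where
  "haar_measurable F \<longleftrightarrow> hmat -` F \<in> sets lborel"

definition haar :: "mat3 set \<Rightarrow> ennreal" where
  "haar F = emeasure lborel (hmat -` F)"

definition is_subgroup_H3 :: "mat3 set \<Rightarrow> bool" where
  "is_subgroup_H3 G \<longleftrightarrow> G \<subseteq> H3 \<and> mat 1 \<in> G \<and>
      (\<forall>x\<in>G. \<forall>y\<in>G. x ** y \<in> G) \<and> (\<forall>x\<in>G. matrix_inv x \<in> G)"

definition discrete_set :: "mat3 set \<Rightarrow> bool" where
  "discrete_set G \<longleftrightarrow> (\<forall>x\<in>G. \<exists>e>0. \<forall>y\<in>G. dist y x < e \<longrightarrow> y = x)"

definition finite_covolume :: "mat3 set \<Rightarrow> bool" where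
  "finite_covolume G \<longleftrightarrow> (\<exists>F. F \<subseteq> H3 \<and> haar_measurable F \<and> haar F < \<infinity> \<and>
      (\<forall>g\<in>H3. \<exists>!f. f \<in> F \<and> (\<exists>\<gamma>\<in>G. g = f ** \<gamma>)))"

definition lattice_H3 :: "mat3 set \<Rightarrow> bool" where
  "lattice_H3 G \<longleftrightarrow> is_subgroup_H3 G \<and> discrete_set G \<and> finite_covolume G"

definition lcoset :: "mat3 \<Rightarrow> mat3 set \<Rightarrow> mat3 set" where
  "lcoset g G = (\<lambda>y. g ** y) ` G"

definition quot :: "mat3 set \<Rightarrow> mat3 set set" where
  "quot G = {lcoset g G | g. g \<in> H3}"

definition quot_space :: "mat3 set \<Rightarrow> mat3 set measure" where
  "quot_space G = sigma (quot G)
     {A. A \<subseteq> quot G \<and> {g\<in>H3. lcoset g G \<in> A} \<in> sets borel}"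

definition ltrans :: "mat3 \<Rightarrow> mat3 set \<Rightarrow> mat3 set" where
  "ltrans g C = (\<lambda>y. g ** y) ` C"

definition invariant_prob :: "mat3 set \<Rightarrow> mat3 set measure \<Rightarrow> bool" where
  "invariant_prob G \<nu> \<longleftrightarrow> sets \<nu> = sets (quot_space G) \<and> prob_space \<nu> \<and>
     (\<forall>g\<in>H3. \<forall>A\<in>sets \<nu>. emeasure \<nu> {C \<in> quot G. ltrans g C \<in> A} = emeasure \<nu> A)"

text \<open>The inverse limit X = lim_{<-} H_3(R)/Gamma_j: compatible sequences of cosets
  (the bonding map H/Gamma_{j+1} -> H/Gamma_j sends g Gamma_{j+1} to g Gamma_j, i.e.
  to the unique Gamma_j-coset containing it).\<close>
definition odo :: "(nat \<Rightarrow> mat3 set) \<Rightarrow> (nat \<Rightarrow> mat3 set) set" where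
  "odo \<Gamma> = {x. (\<forall>j. x j \<in> quot (\<Gamma> j)) \<and> (\<forall>j. x (Suc j) \<subseteq> x j)}"

definition odo_space :: "(nat \<Rightarrow> mat3 set) \<Rightarrow> (nat \<Rightarrow> mat3 set) measure" where
  "odo_space \<Gamma> = sigma (odo \<Gamma>)
     {{x \<in> odo \<Gamma>. x j \<in> A} | j A. A \<in> sets (quot_space (\<Gamma> j))}"

definition odo_action :: "mat3 \<Rightarrow> (nat \<Rightarrow> mat3 set) \<Rightarrow> (nat \<Rightarrow> mat3 set)" where
  "odo_action g x = (\<lambda>j. ltrans g (x j))"

definition odo_measure :: "(nat \<Rightarrow> mat3 set) \<Rightarrow> (nat \<Rightarrow> mat3 set) measure \<Rightarrow> bool" where
  "odo_measure \<Gamma> \<mu> \<longleftrightarrow> sets \<mu> = sets (odo_space \<Gamma>) \<and> prob_space \<mu> \<and>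
     (\<forall>j. invariant_prob (\<Gamma> j) (distr \<mu> (quot_space (\<Gamma> j)) (\<lambda>x. x j)))"

definition stabilizer :: "(nat \<Rightarrow> mat3 set) \<Rightarrow> mat3 set" where
  "stabilizer x = {g \<in> H3. odo_action g x = x}"

definition odo_free :: "(nat \<Rightarrow> mat3 set) \<Rightarrow> (nat \<Rightarrow> mat3 set) measure \<Rightarrow> bool" where
  "odo_free \<Gamma> \<mu> \<longleftrightarrow> (AE x in \<mu>. stabilizer x = {mat 1})"

end

theory Submission
  imports Defs
begin

text \<open>
  A central element fixes a point of the odometer iff it lies in every \<open>\<Gamma> n\<close>, which gives one
  direction. For the other, fix \<open>(a, b) \<noteq> (0, 0)\<close>, one of the countably many possible
  projections to the abelianization of an element of a stabilizer. If the matrix with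
  coordinates \<open>(a, b, s)\<close> fixes a coset \<open>C\<close> of \<open>\<Gamma> n\<close>, then \<open>s\<close> is determined modulo the central
  part of \<open>\<Gamma> n\<close>, and translating \<open>C\<close> shifts \<open>s\<close> by an arbitrary prescribed amount. By invariance
  \<open>s\<close> is therefore uniformly distributed modulo the central part. As \<open>n\<close> grows the gaps in the
  central part tend to infinity, so the probability that \<open>s\<close> lies in a given unit interval is zero.
\<close>

section \<open>Heisenberg coordinates and stabilizers of cosets\<close>

lemma hmat_nth [simp]:
  "hmat p $ 1 $ 1 = 1" "hmat p $ 2 $ 2 = 1" "hmat p $ 3 $ 3 = 1"
  "hmat p $ 2 $ 1 = 0" "hmat p $ 3 $ 1 = 0" "hmat p $ 3 $ 2 = 0"
  "hmat p $ 1 $ 2 = fst p" "hmat p $ 2 $ 3 = fst (snd p)" "hmat p $ 1 $ 3 = snd (snd p)"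
  by (simp_all add: hmat_def)

lemma hmat_mult: "hmat (a, b, c) ** hmat (p, q, r) = hmat (a + p, b + q, c + r + a * q)"
  by (simp add: vec_eq_iff forall_3 matrix_matrix_mult_def sum_3)

lemma hmat_eq_iff: "hmat p = hmat q \<longleftrightarrow> p = q"
  by (auto simp: vec_eq_iff forall_3 prod_eq_iff)

lemma hmat_zero: "hmat (0, 0, 0) = mat 1"
  by (simp add: vec_eq_iff forall_3 mat_def)

lemma hmat_in_H3: "hmat p \<in> H3"
  by (simp add: H3_def)

lemma H3_coordinates: "M \<in> H3 \<Longrightarrow> M = hmat (M$1$2, M$2$3, M$1$3)"
  by (simp add: H3_def vec_eq_iff forall_3)

lemma H3_cases:
  assumes "M \<in> H3"
  obtains a b c where "M = hmat (a, b, c)"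
  using H3_coordinates[OF assms] by blast

lemma quot_cases:
  assumes "C \<in> quot G"
  obtains p q r where "C = lcoset (hmat (p, q, r)) G"
proof -
  obtain g where "g \<in> H3" "C = lcoset g G"
    using assms by (auto simp: quot_def)
  then show thesis using that H3_cases by metis
qed

lemma matrix_inv_hmat: "matrix_inv (hmat (a, b, c)) = hmat (- a, - b, a * b - c)"
proof -
  let ?A = "hmat (a, b, c)" and ?B = "hmat (- a, - b, a * b - c)"
  have AB: "?A ** ?B = mat 1" "?B ** ?A = mat 1"
    by (simp_all add: hmat_mult hmat_zero)
  \<comment> \<open>\<open>matrix_inv\<close> is a choice among two-sided inverses, so
    \<open>?B\<close> serves as the existence witness; multiplying by \<open>?B\<close> on the left
    then pins the choice down.\<close>
  then have "?A ** matrix_inv ?A = mat 1"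
    unfolding matrix_inv_def by (metis (mono_tags, lifting) someI_ex)
  then have "?B ** (?A ** matrix_inv ?A) = ?B" by simp
  then show ?thesis by (simp add: matrix_mul_assoc AB)
qed

lemma subgroup_H3_divide:
  assumes "is_subgroup_H3 G" "hmat (a, b, c) \<in> G" "hmat (a, b, c') \<in> G"
  shows "cent (c' - c) \<in> G"
proof -
  have "matrix_inv (hmat (a, b, c)) ** hmat (a, b, c') \<in> G"
    using assms by (simp add: is_subgroup_H3_def)
  then show ?thesis
    by (simp add: matrix_inv_hmat hmat_mult cent_def)
qed

text \<open>The stabilizer of \<open>gG\<close> is the conjugate of \<open>G\<close> by
  \<open>g\<close>. Conjugation keeps the abelianization coordinates \<open>(a, b)\<close> and only
  moves the central one, by the commutator term \<open>a * q - p * b\<close>.\<close>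

lemma ltrans_lcoset_eq_iff:
  assumes G: "is_subgroup_H3 G"
  shows "ltrans (hmat (a, b, s)) (lcoset (hmat (p, q, r)) G) = lcoset (hmat (p, q, r)) G
    \<longleftrightarrow> hmat (a, b, s + a * q - p * b) \<in> G" (is "?stab \<longleftrightarrow> ?\<gamma> \<in> G")
proof -
  let ?M = "hmat (a, b, s)" and ?g = "hmat (p, q, r)"
  have conj: "?M ** ?g = ?g ** ?\<gamma>"
    by (simp add: hmat_mult hmat_eq_iff)
  have ltrans: "ltrans ?M (lcoset ?g G) = (\<lambda>y. ?g ** (?\<gamma> ** y)) ` G"
    by (simp add: ltrans_def lcoset_def image_image matrix_mul_assoc conj)
  have one: "mat 1 \<in> G"
    using G by (simp add: is_subgroup_H3_def)
  show ?thesis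
  proof
    assume ?stab
    then have "?g ** (?\<gamma> ** mat 1) \<in> lcoset ?g G"
      using one unfolding ltrans by blast
    then obtain y where y: "y \<in> G" "?g ** ?\<gamma> = ?g ** y"
      by (auto simp: lcoset_def)
    then have "matrix_inv ?g ** (?g ** ?\<gamma>) = matrix_inv ?g ** (?g ** y)"
      by simp
    then have "?\<gamma> = y"
      by (simp add: matrix_mul_assoc) (simp add: matrix_inv_hmat hmat_mult hmat_zero)
    with y show "?\<gamma> \<in> G" by simp
  next
    assume mem: "?\<gamma> \<in> G"
    have inv: "matrix_inv ?\<gamma> \<in> G"
      using G mem by (simp add: is_subgroup_H3_def)
    have "(\<lambda>y. ?\<gamma> ** y) ` G = G"
    proof
      show "(\<lambda>y. ?\<gamma> ** y) ` G \<subseteq> G"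
        using G mem by (auto simp: is_subgroup_H3_def)
      show "G \<subseteq> (\<lambda>y. ?\<gamma> ** y) ` G"
      proof
        fix y assume "y \<in> G"
        then have "matrix_inv ?\<gamma> ** y \<in> G"
          using G inv by (auto simp: is_subgroup_H3_def)
        moreover have "?\<gamma> ** (matrix_inv ?\<gamma> ** y) = y"
          by (simp add: matrix_mul_assoc) (simp add: matrix_inv_hmat hmat_mult hmat_zero)
        ultimately show "y \<in> (\<lambda>y. ?\<gamma> ** y) ` G"
          by (metis imageI)
      qed
    qed
    then have "(\<lambda>y. ?g ** y) ` (\<lambda>y. ?\<gamma> ** y) ` G = lcoset ?g G"
      by (simp add: lcoset_def)
    then show ?stab
      by (simp only: ltrans image_image)
  qed
qed

section \<open>Discreteness: countability and the central part\<close>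

lemma discrete_set_imp_countable:
  assumes "discrete_set G"
  shows "countable G"
proof -
  obtain \<B> :: "mat3 set set" where \<B>: "countable \<B>" "topological_basis \<B>"
    using ex_countable_basis by blast
  \<comment> \<open>Second countability: an isolated point is cut out of \<open>G\<close> by one
    basic open set, so the countable basis enumerates \<open>G\<close>.\<close>
  have "\<exists>B\<in>\<B>. B \<inter> G = {x}" if x: "x \<in> G" for x
  proof -
    obtain e where e: "e > 0" "\<And>y. y \<in> G \<Longrightarrow> dist y x < e \<Longrightarrow> y = x"
      using assms x unfolding discrete_set_def by blast
    have "x \<in> ball x e" using e(1) by simp
    then obtain B where B: "B \<in> \<B>" "x \<in> B" "B \<subseteq> ball x e"
      using topological_basisE[OF \<B>(2) open_ball] by metis
    have "y = x" if "y \<in> B \<inter> G" for y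
    proof (rule e(2))
      show "dist y x < e" using B(3) that by (auto simp: dist_commute)
    qed (use that in blast)
    then show ?thesis using B x by blast
  qed
  then have "G \<subseteq> (\<lambda>B. the_elem (B \<inter> G)) ` \<B>"
    by (intro subsetI) (metis rev_image_eqI the_elem_eq)
  then show ?thesis
    using \<B>(1) by (meson countable_image countable_subset)
qed

text \<open>Differences of central parameters are again central parameters, so the isolation radius
  \<open>e\<close> at the identity separates them all. Cells of length \<open>e\<close> therefore
  hold at most one each, and finitely many cells meet a bounded interval.\<close>

lemma finite_central_part:
  assumes G: "is_subgroup_H3 G" and "discrete_set G"
  shows "finite {t. cent t \<in> G \<and> \<bar>t\<bar> < m}"
proof -
  have "mat 1 \<in> G"
    using G by (simp add: is_subgroup_H3_def)
  then obtain e where e: "e > 0" "\<And>y. y \<in> G \<Longrightarrow> dist y (mat 1) < e \<Longrightarrow> y = mat 1"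
    using \<open>discrete_set G\<close> unfolding discrete_set_def by blast
  have dist_cent: "dist (cent t) (mat 1) = \<bar>t\<bar>" for t
    by (simp add: dist_norm norm_vec_def L2_set_def sum_3 cent_def flip: hmat_zero)
  have separated: "t = t'" if "cent t \<in> G" "cent t' \<in> G" "\<bar>t' - t\<bar> < e" for t t'
  proof -
    have "cent (t' - t) \<in> G"
      using subgroup_H3_divide[OF G, of 0 0 t t'] that by (simp add: cent_def)
    then have "cent (t' - t) = mat 1"
      using e(2) dist_cent that by metis
    then show ?thesis
      by (simp add: cent_def hmat_eq_iff flip: hmat_zero)
  qed
  let ?T = "{t. cent t \<in> G \<and> \<bar>t\<bar> < m}"
  have "inj_on (\<lambda>t. \<lfloor>t / e\<rfloor>) ?T"
  proof (rule inj_onI)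
    fix t t' assume t: "t \<in> ?T" "t' \<in> ?T" "\<lfloor>t / e\<rfloor> = \<lfloor>t' / e\<rfloor>"
    then have "\<bar>t' / e - t / e\<bar> < 1" by linarith
    then have "\<bar>t' - t\<bar> < e"
      using e(1) by (simp add: field_simps abs_less_iff)
    with t show "t = t'" using separated by blast
  qed
  moreover have "(\<lambda>t. \<lfloor>t / e\<rfloor>) ` ?T \<subseteq> {\<lfloor>- m / e\<rfloor>..\<lfloor>m / e\<rfloor>}"
  proof (rule image_subsetI)
    fix t assume "t \<in> ?T"
    then have "- m \<le> t" "t \<le> m" by auto
    then have "- m / e \<le> t / e" "t / e \<le> m / e"
      using e(1) by (simp_all only: divide_right_mono less_imp_le)
    then show "\<lfloor>t / e\<rfloor> \<in> {\<lfloor>- m / e\<rfloor>..\<lfloor>m / e\<rfloor>}"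
      by (auto intro: floor_mono)
  qed
  ultimately show ?thesis
    by (meson finite_atLeastAtMost_int inj_on_finite)
qed

text \<open>Nonzero parameters below \<open>m\<close> in any \<open>\<Gamma> n\<close> already occur
  in \<open>\<Gamma> 0\<close>, where there are finitely many. Each drops out at some stage, and by
  monotonicity all are gone by the latest of these.\<close>

lemma central_part_escapes:
  assumes lat: "\<And>n. is_subgroup_H3 (\<Gamma> n)" "\<And>n. discrete_set (\<Gamma> n)"
    and dec: "\<And>n. \<Gamma> (Suc n) \<subseteq> \<Gamma> n"
    and triv: "range cent \<inter> (\<Inter>n. \<Gamma> n) = {mat 1}"
  shows "\<exists>n. \<forall>t. cent t \<in> \<Gamma> n \<longrightarrow> \<bar>t\<bar> < m \<longrightarrow> t = 0"
proof -
  let ?T = "{t. cent t \<in> \<Gamma> 0 \<and> \<bar>t\<bar> < m}"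
  have anti: "\<Gamma> n \<subseteq> \<Gamma> k" if "k \<le> n" for k n
    using lift_Suc_antimono_le[of \<Gamma>, OF dec that] .
  have fin: "finite ?T"
    using finite_central_part lat by blast
  have "\<exists>n. cent t \<notin> \<Gamma> n" if "t \<noteq> 0" for t
  proof (rule ccontr)
    assume "\<not> ?thesis"
    then have "cent t \<in> range cent \<inter> (\<Inter>n. \<Gamma> n)" by blast
    with triv have "cent t = mat 1" by blast
    with that show False
      by (simp add: cent_def hmat_eq_iff flip: hmat_zero)
  qed
  then obtain N where N: "\<And>t. t \<noteq> 0 \<Longrightarrow> cent t \<notin> \<Gamma> (N t)" by metis
  \<comment> \<open>\<open>insert 0\<close> keeps the maximum meaningful when \<open>m\<close> is
    not positive and \<open>?T\<close> is empty. The arbitrary value \<open>N 0\<close> can only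
    enlarge it.\<close>
  have "t = 0" if "cent t \<in> \<Gamma> (Max (insert 0 (N ` ?T)))" "\<bar>t\<bar> < m" for t
  proof (rule ccontr)
    assume "t \<noteq> 0"
    have "t \<in> ?T" using that anti by blast
    then have "N t \<le> Max (insert 0 (N ` ?T))"
      using fin by (intro Max_ge) auto
    then show False
      using N[OF \<open>t \<noteq> 0\<close>] that(1) anti by blast
  qed
  then show ?thesis by blast
qed

section \<open>Distribution of the central coordinate of a stabilizing element\<close>

text \<open>The parameter \<open>s\<close> ranges over a continuum; sorting by its integer part
  leaves countably many events, few enough for an almost-everywhere argument.\<close>

definition stab_level :: "mat3 set \<Rightarrow> real \<Rightarrow> real \<Rightarrow> int \<Rightarrow> mat3 set set" where
  "stab_level G a b k = {C \<in> quot G. \<exists>s. \<lfloor>s\<rfloor> = k \<and> ltrans (hmat (a, b, s)) C = C}"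

lemma sets_quot_space:
  "sets (quot_space G) = sigma_sets (quot G)
     {A. A \<subseteq> quot G \<and> {g\<in>H3. lcoset g G \<in> A} \<in> sets borel}"
  unfolding quot_space_def by (rule sets_measure_of) blast

lemma H3_borel: "H3 \<in> sets borel"
proof -
  have "closed H3"
    unfolding H3_def by (intro closed_Collect_conj closed_Collect_eq continuous_intros)
  then show ?thesis by (rule borel_closed)
qed

text \<open>Each element of \<open>G\<close> over \<open>(a, b)\<close> forces one value of
  \<open>s\<close> at \<open>gG\<close>, depending continuously on \<open>g\<close>. Countability of
  \<open>G\<close> makes the preimage in \<open>H3\<close> a countable union of Borel sets.\<close>

lemma stab_level_measurable:
  assumes G: "is_subgroup_H3 G" and "countable G"
  shows "stab_level G a b k \<in> sets (quot_space G)"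
proof -
  \<comment> \<open>This solves the condition of \<open>ltrans_lcoset_eq_iff\<close> for
    \<open>s\<close>.\<close>
  let ?f = "\<lambda>(\<gamma> :: mat3) (g :: mat3). \<gamma>$1$3 - a * g$2$3 + g$1$2 * b :: real"
  let ?U = "\<lambda>\<gamma>. H3 \<inter> ?f \<gamma> -` {of_int k..<of_int k + 1}"
  have "{g\<in>H3. lcoset g G \<in> stab_level G a b k}
      = (\<Union>\<gamma>\<in>{\<gamma>\<in>G. \<gamma>$1$2 = a \<and> \<gamma>$2$3 = b}. ?U \<gamma>)" (is "?L = ?R")
  proof (intro set_eqI iffI)
    fix g assume g: "g \<in> ?L"
    then obtain p q r where gc: "g = hmat (p, q, r)" using H3_cases by blast
    from g obtain s where "\<lfloor>s\<rfloor> = k" and mem: "hmat (a, b, s + a * q - p * b) \<in> G"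
      by (auto simp: stab_level_def gc ltrans_lcoset_eq_iff[OF G])
    then have "g \<in> ?U (hmat (a, b, s + a * q - p * b))"
      by (auto simp: gc hmat_in_H3)
    with mem show "g \<in> ?R" by (intro UN_I) auto
  next
    fix g assume "g \<in> ?R"
    then obtain \<gamma> where \<gamma>: "\<gamma> \<in> G" "\<gamma>$1$2 = a" "\<gamma>$2$3 = b" "g \<in> ?U \<gamma>" by auto
    then obtain p q r where gc: "g = hmat (p, q, r)" using H3_cases by blast
    obtain c where \<gamma>c: "\<gamma> = hmat (a, b, c)"
      using G \<gamma> H3_coordinates unfolding is_subgroup_H3_def by blast
    have "\<lfloor>c - a * q + p * b\<rfloor> = k"
      using \<gamma>(4) by (simp add: gc \<gamma>c floor_eq_iff)
    moreover have "ltrans (hmat (a, b, c - a * q + p * b)) (lcoset g G) = lcoset g G"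
      using \<gamma>(1) by (simp add: gc \<gamma>c ltrans_lcoset_eq_iff[OF G])
    ultimately show "g \<in> ?L"
      using \<gamma>(4) by (auto simp: stab_level_def quot_def)
  qed
  moreover have "?U \<gamma> \<in> sets borel" for \<gamma>
  proof -
    have "?f \<gamma> \<in> borel_measurable borel"
      by (intro borel_measurable_continuous_onI continuous_intros)
    then have "?f \<gamma> -` {of_int k..<of_int k + 1} \<in> sets borel"
      using measurable_sets[of "?f \<gamma>" borel borel "{of_int k..<of_int k + 1}"] by simp
    then show ?thesis using H3_borel by blast
  qed
  moreover have "countable {\<gamma>\<in>G. \<gamma>$1$2 = a \<and> \<gamma>$2$3 = b}"
    using \<open>countable G\<close> by (rule countable_subset[rotated]) blast
  ultimately have "{g\<in>H3. lcoset g G \<in> stab_level G a b k} \<in> sets borel"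
    by (simp only: sets.countable_UN'')
  then show ?thesis
    unfolding sets_quot_space by (intro sigma_sets.Basic) (auto simp: stab_level_def)
qed

text \<open>With \<open>h = hmat (p, q, 0)\<close>, a matrix fixes \<open>C\<close> iff its
  conjugate by \<open>h\<close> fixes \<open>hC\<close>; this conjugation adds
  \<open>p * b - a * q\<close> to the central coordinate.\<close>

lemma ltrans_stab_level:
  assumes G: "is_subgroup_H3 G"
  shows "{C \<in> quot G. ltrans (hmat (p, q, 0)) C \<in> stab_level G a b k}
    = {C \<in> quot G. \<exists>s. \<lfloor>s + p * b - a * q\<rfloor> = k \<and> ltrans (hmat (a, b, s)) C = C}"
proof -
  have "ltrans (hmat (p, q, 0)) C \<in> stab_level G a b k \<longleftrightarrow>
      (\<exists>s. \<lfloor>s + p * b - a * q\<rfloor> = k \<and> ltrans (hmat (a, b, s)) C = C)" if "C \<in> quot G" for C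
  proof -
    from that obtain x y z where C: "C = lcoset (hmat (x, y, z)) G"
      by (rule quot_cases)
    have hC: "ltrans (hmat (p, q, 0)) C = lcoset (hmat (p + x, q + y, z + p * y)) G"
      by (simp add: C ltrans_def lcoset_def image_image matrix_mul_assoc hmat_mult)
    then have quot: "ltrans (hmat (p, q, 0)) C \<in> quot G"
      using hmat_in_H3 by (auto simp: quot_def)
    have "(\<exists>s. \<lfloor>s\<rfloor> = k \<and> hmat (a, b, s + a * (q + y) - (p + x) * b) \<in> G) \<longleftrightarrow>
        (\<exists>s. \<lfloor>s + p * b - a * q\<rfloor> = k \<and> hmat (a, b, s + a * y - x * b) \<in> G)" (is "?l \<longleftrightarrow> ?r")
    proof
      assume ?l
      then obtain s where s: "\<lfloor>s\<rfloor> = k" "hmat (a, b, s + a * (q + y) - (p + x) * b) \<in> G" by blast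
      show ?r
        by (rule exI[of _ "s - p * b + a * q"]) (use s in \<open>simp add: algebra_simps\<close>)
    next
      assume ?r
      then obtain s where s: "\<lfloor>s + p * b - a * q\<rfloor> = k" "hmat (a, b, s + a * y - x * b) \<in> G" by blast
      show ?l
        by (rule exI[of _ "s + p * b - a * q"]) (use s in \<open>simp add: algebra_simps\<close>)
    qed
    then show ?thesis
      using quot by (simp add: stab_level_def hC) (simp add: C ltrans_lcoset_eq_iff[OF G])
  qed
  then show ?thesis by blast
qed

text \<open>Since \<open>(a, b)\<close> is nonzero, \<open>p * b - a * q\<close> takes every real
  value. A translation with value \<open>j\<close> pulls level \<open>k\<close> back to level
  \<open>k - j\<close>, and invariance applies.\<close>

lemma emeasure_stab_level_shift:
  assumes G: "is_subgroup_H3 G" "countable G" and \<nu>: "invariant_prob G \<nu>"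
    and ab: "(a, b) \<noteq> (0, 0)"
  shows "emeasure \<nu> (stab_level G a b (k - j)) = emeasure \<nu> (stab_level G a b k)"
proof -
  obtain p q where pq: "p * b - a * q = real_of_int j"
  proof (cases "a = 0")
    case True
    then show ?thesis using ab that[of "j / b" 0] by simp
  next
    case False
    then show ?thesis using that[of 0 "- j / a"] by simp
  qed
  have "\<lfloor>s + p * b - a * q\<rfloor> = k \<longleftrightarrow> \<lfloor>s\<rfloor> = k - j" for s
  proof -
    have "s + p * b - a * q = s + real_of_int j" using pq by simp
    then show ?thesis
      by (metis add_diff_cancel_right' diff_add_cancel floor_add_int)
  qed
  then have "{C \<in> quot G. ltrans (hmat (p, q, 0)) C \<in> stab_level G a b k}
      = stab_level G a b (k - j)"
    unfolding ltrans_stab_level[OF G(1)] by (simp add: stab_level_def)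
  moreover have "stab_level G a b k \<in> sets \<nu>"
    using stab_level_measurable[OF G] \<nu> by (simp add: invariant_prob_def)
  then have "emeasure \<nu> {C \<in> quot G. ltrans (hmat (p, q, 0)) C \<in> stab_level G a b k}
      = emeasure \<nu> (stab_level G a b k)"
    using \<nu> hmat_in_H3 unfolding invariant_prob_def by blast
  ultimately show ?thesis by simp
qed

text \<open>Two values of \<open>s\<close> fixing the same coset differ by the parameter of a
  central element of \<open>G\<close>. A gap of \<open>m\<close> forbids this across
  \<open>m\<close> consecutive unit cells.\<close>

lemma stab_level_disjoint:
  assumes G: "is_subgroup_H3 G"
    and gap: "\<And>t. cent t \<in> G \<Longrightarrow> \<bar>t\<bar> < real m \<Longrightarrow> t = 0"
  shows "disjoint_family_on (\<lambda>j. stab_level G a b (k - int j)) {..<m}"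
  unfolding disjoint_family_on_def
proof (intro ballI impI)
  fix i j assume ij: "i \<in> {..<m}" "j \<in> {..<m}" "i \<noteq> j"
  show "stab_level G a b (k - int i) \<inter> stab_level G a b (k - int j) = {}"
  proof (rule ccontr)
    assume "\<not> ?thesis"
    then obtain C s t where C: "C \<in> quot G"
      and s: "\<lfloor>s\<rfloor> = k - int i" "ltrans (hmat (a, b, s)) C = C"
      and t: "\<lfloor>t\<rfloor> = k - int j" "ltrans (hmat (a, b, t)) C = C"
      unfolding stab_level_def by blast
    from C obtain x y z where "C = lcoset (hmat (x, y, z)) G"
      by (rule quot_cases)
    then have "cent (t - s) \<in> G"
      using subgroup_H3_divide[OF G, of a b "s + a * y - x * b" "t + a * y - x * b"] s t
      by (simp add: ltrans_lcoset_eq_iff[OF G])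
    \<comment> \<open>The integer parts differ by at most \<open>m - 1\<close> and the fractional
      parts by less than \<open>1\<close>, hence the strict bound.\<close>
    moreover have "\<bar>t - s\<bar> < real m"
      using s(1) t(1) ij by (simp add: floor_eq_iff) linarith
    ultimately have "t = s" using gap by fastforce
    with s(1) t(1) ij(3) show False by simp
  qed
qed

text \<open>The \<open>m\<close> consecutive levels are disjoint and equally likely, and their union
  has probability at most \<open>1\<close>.\<close>

lemma emeasure_stab_level_le:
  assumes G: "is_subgroup_H3 G" "countable G" and \<nu>: "invariant_prob G \<nu>"
    and ab: "(a, b) \<noteq> (0, 0)"
    and gap: "\<And>t. cent t \<in> G \<Longrightarrow> \<bar>t\<bar> < real m \<Longrightarrow> t = 0"
  shows "of_nat m * emeasure \<nu> (stab_level G a b k) \<le> 1"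
proof -
  have "of_nat m * emeasure \<nu> (stab_level G a b k)
      = (\<Sum>j<m. emeasure \<nu> (stab_level G a b (k - int j)))"
    by (simp add: emeasure_stab_level_shift[OF G \<nu> ab])
  also have "\<dots> = emeasure \<nu> (\<Union>j<m. stab_level G a b (k - int j))"
    using stab_level_measurable[OF G] \<nu>
    by (intro sum_emeasure stab_level_disjoint[OF G(1) gap]) (auto simp: invariant_prob_def)
  also have "\<dots> \<le> 1"
    using \<nu> by (simp add: invariant_prob_def prob_space.emeasure_le_1)
  finally show ?thesis .
qed

section \<open>Null sets in the inverse limit\<close>

lemma sets_odo_space:
  "sets (odo_space \<Gamma>) = sigma_sets (odo \<Gamma>)
     {{x \<in> odo \<Gamma>. x j \<in> A} | j A. A \<in> sets (quot_space (\<Gamma> j))}"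
  unfolding odo_space_def by (rule sets_measure_of) blast

lemma space_odo_space: "space (odo_space \<Gamma>) = odo \<Gamma>"
  unfolding odo_space_def by (rule space_measure_of) blast

lemma odo_coordinate_measurable: "(\<lambda>x. x j) \<in> measurable (odo_space \<Gamma>) (quot_space (\<Gamma> j))"
proof (rule measurableI)
  fix x assume "x \<in> space (odo_space \<Gamma>)"
  moreover have "space (quot_space (\<Gamma> j)) = quot (\<Gamma> j)"
    unfolding quot_space_def by (rule space_measure_of) blast
  ultimately show "x j \<in> space (quot_space (\<Gamma> j))"
    by (simp add: space_odo_space odo_def)
next
  fix A assume "A \<in> sets (quot_space (\<Gamma> j))"
  moreover have "(\<lambda>x. x j) -` A \<inter> space (odo_space \<Gamma>) = {x \<in> odo \<Gamma>. x j \<in> A}"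
    by (auto simp: space_odo_space)
  ultimately show "(\<lambda>x. x j) -` A \<inter> space (odo_space \<Gamma>) \<in> sets (odo_space \<Gamma>)"
    unfolding sets_odo_space by auto
qed

text \<open>A stage with central gap at least \<open>m\<close> bounds the event that all coordinates
  lie in their level sets by \<open>1 / m\<close>, and \<open>m\<close> is arbitrary. The index
  \<open>k\<close> is common to all stages because a single matrix has to fix every
  coordinate.\<close>

lemma AE_not_all_stab_level:
  assumes lat: "\<And>n. is_subgroup_H3 (\<Gamma> n)" "\<And>n. discrete_set (\<Gamma> n)"
    and dec: "\<And>n. \<Gamma> (Suc n) \<subseteq> \<Gamma> n"
    and triv: "range cent \<inter> (\<Inter>n. \<Gamma> n) = {mat 1}"
    and \<mu>: "odo_measure \<Gamma> \<mu>"
    and ab: "(a, b) \<noteq> (0, 0)"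
  shows "AE x in \<mu>. \<exists>n. x n \<notin> stab_level (\<Gamma> n) a b k"
proof -
  have cnt: "countable (\<Gamma> n)" for n
    by (rule discrete_set_imp_countable[OF lat(2)])
  have sets: "sets \<mu> = sets (odo_space \<Gamma>)" and \<nu>: "\<And>n. invariant_prob (\<Gamma> n) (distr \<mu> (quot_space (\<Gamma> n)) (\<lambda>x. x n))"
    using \<mu> by (simp_all add: odo_measure_def)
  have meas: "(\<lambda>x. x n) \<in> measurable \<mu> (quot_space (\<Gamma> n))" for n
    using odo_coordinate_measurable measurable_cong_sets[OF sets refl] by blast
  let ?P = "\<lambda>n. (\<lambda>x. x n) -` stab_level (\<Gamma> n) a b k \<inter> space \<mu>"
  have P: "?P n \<in> sets \<mu>" for n
    by (rule measurable_sets[OF meas stab_level_measurable[OF lat(1) cnt]])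
  have bound: "of_nat m * emeasure \<mu> (\<Inter>n. ?P n) \<le> 1" for m
  proof -
    obtain n where n: "\<And>t. cent t \<in> \<Gamma> n \<Longrightarrow> \<bar>t\<bar> < real m \<Longrightarrow> t = 0"
      using central_part_escapes[OF lat dec triv] by blast
    have "emeasure \<mu> (\<Inter>n. ?P n) \<le> emeasure \<mu> (?P n)"
      by (rule emeasure_mono[OF _ P]) blast
    also have "\<dots> = emeasure (distr \<mu> (quot_space (\<Gamma> n)) (\<lambda>x. x n)) (stab_level (\<Gamma> n) a b k)"
      by (rule emeasure_distr[symmetric, OF meas stab_level_measurable[OF lat(1) cnt]])
    finally have "of_nat m * emeasure \<mu> (\<Inter>n. ?P n)
        \<le> of_nat m * emeasure (distr \<mu> (quot_space (\<Gamma> n)) (\<lambda>x. x n)) (stab_level (\<Gamma> n) a b k)"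
      by (rule mult_left_mono) simp
    also have "\<dots> \<le> 1"
      by (rule emeasure_stab_level_le[OF lat(1) cnt \<nu> ab n])
    finally show ?thesis .
  qed
  \<comment> \<open>The Archimedean property rules out a positive finite value, and
    \<open>m = 1\<close> rules out infinity.\<close>
  have "emeasure \<mu> (\<Inter>n. ?P n) = 0"
  proof (cases "emeasure \<mu> (\<Inter>n. ?P n)")
    case (real r)
    have "real m * r \<le> 1" for m
      using bound[of m] real by (simp add: ennreal_of_nat_eq_real_of_nat flip: ennreal_mult)
    then have "r \<le> 0"
      using reals_Archimedean3[of r] by (meson linorder_not_le)
    with real show ?thesis by (simp add: ennreal_neg)
  next
    case top
    then show ?thesis using bound[of 1] by (simp add: top_unique)
  qed
  then have "(\<Inter>n. ?P n) \<in> null_sets \<mu>"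
    using P by (intro null_setsI sets.countable_INT) auto
  then show ?thesis
    by (rule AE_I') auto
qed

section \<open>The freeness criterion\<close>

theorem theorem3p1:
  fixes \<Gamma> :: "nat \<Rightarrow> mat3 set" and \<mu> :: "(nat \<Rightarrow> mat3 set) measure"
  assumes "\<And>n. lattice_H3 (\<Gamma> n)"
    and "\<And>n. \<Gamma> (Suc n) \<subseteq> \<Gamma> n"
    and "odo_measure \<Gamma> \<mu>"
  shows "odo_free \<Gamma> \<mu> \<longleftrightarrow> range cent \<inter> (\<Inter>n. \<Gamma> n) = {mat 1}"
proof -
  have lat: "is_subgroup_H3 (\<Gamma> n)" "discrete_set (\<Gamma> n)" for n
    using assms(1) by (simp_all add: lattice_H3_def)
  have one: "mat 1 \<in> \<Gamma> n" for n
    using lat(1) by (simp add: is_subgroup_H3_def)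
  have space: "space \<mu> = odo \<Gamma>"
    using assms(3) sets_eq_imp_space_eq[of \<mu> "odo_space \<Gamma>"]
    by (simp add: odo_measure_def space_odo_space)
  have coset: "\<exists>p q r. x n = lcoset (hmat (p, q, r)) (\<Gamma> n)" if "x \<in> odo \<Gamma>" for x n
  proof -
    have "x n \<in> quot (\<Gamma> n)" using that by (simp add: odo_def)
    then show ?thesis by (metis quot_cases)
  qed
  \<comment> \<open>Central elements are unchanged by conjugation, so whether one fixes a coordinate
    does not depend on the point.\<close>
  have fix_cent: "ltrans (cent t) (x n) = x n \<longleftrightarrow> cent t \<in> \<Gamma> n" if "x \<in> odo \<Gamma>" for x n t
  proof -
    from coset[OF that] obtain p q r where "x n = lcoset (hmat (p, q, r)) (\<Gamma> n)"
      by blast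
    then show ?thesis
      by (simp add: cent_def ltrans_lcoset_eq_iff[OF lat(1)])
  qed
  show ?thesis
  proof
    assume "odo_free \<Gamma> \<mu>"
    then have AE: "AE x in \<mu>. x \<in> space \<mu> \<and> stabilizer x = {mat 1}"
      by (simp add: odo_free_def)
    have "prob_space \<mu>" using assms(3) by (simp add: odo_measure_def)
    \<comment> \<open>By \<open>fix_cent\<close> a single point with trivial stabilizer is enough,
      and under a probability measure an almost sure property holds somewhere.\<close>
    then obtain x where x: "x \<in> odo \<Gamma>" "stabilizer x = {mat 1}"
      using eventually_happens'[OF prob_space.ae_filter_bot AE] space by blast
    have "cent t = mat 1" if "\<And>n. cent t \<in> \<Gamma> n" for t
    proof -
      have "cent t \<in> stabilizer x"
        using fix_cent[OF x(1)] that hmat_in_H3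
        by (auto simp: stabilizer_def odo_action_def cent_def)
      with x(2) show ?thesis by simp
    qed
    moreover have "mat 1 \<in> range cent"
      by (rule range_eqI[of _ _ 0]) (simp add: cent_def hmat_zero)
    ultimately show "range cent \<inter> (\<Inter>n. \<Gamma> n) = {mat 1}"
      using one by auto
  next
    assume triv: "range cent \<inter> (\<Inter>n. \<Gamma> n) = {mat 1}"
    \<comment> \<open>Conjugation preserves the abelianization coordinates, so every noncentral
      stabilizer element projects into this countable set, as coordinate \<open>0\<close> already
      shows. Countability lets all exceptional null sets be discarded together.\<close>
    let ?V = "(\<lambda>M. (M$1$2, M$2$3)) ` \<Gamma> 0 - {(0, 0)}"
    have "countable (?V \<times> (UNIV :: int set))"
      using discrete_set_imp_countable[OF lat(2)] by simp
    then have "AE x in \<mu>. \<forall>(v, k) \<in> ?V \<times> UNIV. \<exists>n. x n \<notin> stab_level (\<Gamma> n) (fst v) (snd v) k"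
      unfolding case_prod_beta
      by (subst AE_ball_countable)
        (auto intro!: AE_not_all_stab_level[OF lat assms(2) triv assms(3)])
    then have "AE x in \<mu>. stabilizer x = {mat 1}"
    proof (rule AE_mp, intro AE_I2 impI)
      fix x assume "x \<in> space \<mu>"
        and generic: "\<forall>(v, k) \<in> ?V \<times> UNIV. \<exists>n. x n \<notin> stab_level (\<Gamma> n) (fst v) (snd v) k"
      then have x: "x \<in> odo \<Gamma>" using space by simp
      have "M = mat 1" if "M \<in> stabilizer x" for M
      proof -
        from that have M: "M \<in> H3" "\<And>n. ltrans M (x n) = x n"
          by (auto simp: stabilizer_def odo_action_def fun_eq_iff)
        then obtain a b s where Mc: "M = hmat (a, b, s)" using H3_cases by blast
        show ?thesis
        proof (cases "(a, b) = (0, 0)")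
          case True
          then have "M = cent s" by (simp add: Mc cent_def)
          then have "M \<in> range cent \<inter> (\<Inter>n. \<Gamma> n)"
            using M(2) fix_cent[OF x] by auto
          with triv show ?thesis by blast
        next
          case False
          obtain p q r where "x 0 = lcoset (hmat (p, q, r)) (\<Gamma> 0)" using coset[OF x] by blast
          then have "hmat (a, b, s + a * q - p * b) \<in> \<Gamma> 0"
            using M(2)[of 0] by (simp add: Mc ltrans_lcoset_eq_iff[OF lat(1)])
          then have "(a, b) \<in> ?V"
            using False by (auto intro!: rev_image_eqI)
          \<comment> \<open>The matrix \<open>M\<close> would put every coordinate of
            \<open>x\<close> into the level indexed by the integer part of \<open>s\<close>, which
            \<open>generic\<close> excludes at some \<open>n\<close>.\<close>
          then have "((a, b), \<lfloor>s\<rfloor>) \<in> ?V \<times> UNIV" by blast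
          from bspec[OF generic this] obtain n where "x n \<notin> stab_level (\<Gamma> n) a b \<lfloor>s\<rfloor>"
            by auto
          moreover have "x n \<in> quot (\<Gamma> n)" using x by (simp add: odo_def)
          ultimately show ?thesis
            using M(2)[of n] Mc by (auto simp: stab_level_def)
        qed
      qed
      moreover have "mat 1 \<in> stabilizer x"
        using fix_cent[OF x, of 0] one hmat_in_H3[of "(0, 0, 0)"]
        by (auto simp: stabilizer_def odo_action_def cent_def hmat_zero)
      ultimately show "stabilizer x = {mat 1}" by blast
    qed
    then show "odo_free \<Gamma> \<mu>" by (simp add: odo_free_def)
  qed
qed

end
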